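(* For every integer $t\ge 3$, there exist two pairs of non $\epsilon$-cospectral $\epsilon$-equienergetic graphs on $6+6t$ vertices.
   Context: All graphs are finite, simple, undirected and connected. For a connected graph $G$ with distance function $d$, the eccentricity of a vertex $v$ is $e(v)=\max\{d(v,u):u\in V(G)\}$. The eccentricity matrix $\epsilon(G)$ is the symmetric matrix indexed by $V(G)$ with $(u,v)$ entry $d(u,v)$ if $d(u,v)=\min\{e(u),e(v)\}$, and $0$ otherwise. The $\epsilon$-spectrum of $G$ is the multiset of eigenvalues of $\epsilon(G)$, and the $\epsilon$-energy is the sum of the absolute values of these eigenvalues (with multiplicity). Two non-isomorphic graphs of the same order are $\epsilon$-cospectral if they have the same $\epsilon$-spectrum, and non $\epsilon$-cospectral otherwise. Two graphs of the same order are $\epsilon$-equienergetic if they have the same $\epsilon$-energy. "Two pairs" means two different (unordered) pairs of graphs up to isomorphism, each pair consisting of two graphs that are non $\epsilon$-cospectral and $\epsilon$-equienergetic. *)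

theory Defs
  imports
    "Graph_Theory.Pair_Digraph"
    "Graph_Theory.Digraph_Component"
    "Graph_Theory.Digraph_Isomorphism"
    "Graph_Theory.Shortest_Path"
    "Jordan_Normal_Form.Char_Poly"
begin

text \<open>
  A finite simple undirected graph is a \<open>pair_graph\<close>: a finite loop-free digraph without parallel
  arcs whose arc relation is symmetric, each edge being represented by its two orientations.
\<close>

definition connected_simple_graph :: "'a pair_pre_digraph \<Rightarrow> bool" where
  "connected_simple_graph G \<longleftrightarrow> pair_graph G \<and> Digraph_Component.connected (with_proj G)"

definition graph_order :: "'a pair_pre_digraph \<Rightarrow> nat" where
  "graph_order G = card (pverts G)"

definition graph_isomorphic :: "'a pair_pre_digraph \<Rightarrow> 'b pair_pre_digraph \<Rightarrow> bool" where
  "graph_isomorphic G H \<longleftrightarrow> digraph_iso (with_proj G) (with_proj H)"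

text \<open>The value is meaningful only if \<open>v\<close> is reachable from \<open>u\<close>.\<close>

definition graph_dist :: "'a pair_pre_digraph \<Rightarrow> 'a \<Rightarrow> 'a \<Rightarrow> nat" where
  "graph_dist G u v = (LEAST k. \<exists>p. pre_digraph.awalk (with_proj G) u p v \<and> length p = k)"

lemma graph_dist_eq_unit_weight_shortest_path:
  assumes "wf_digraph (with_proj G)" and "u \<rightarrow>\<^sup>*\<^bsub>with_proj G\<^esub> v"
  shows "wf_digraph.\<mu> (with_proj G) (\<lambda>_. 1) u v = ereal (real (graph_dist G u v))"
proof -
  interpret wf_digraph "with_proj G" by fact
  have cost: "awalk_cost (\<lambda>_. 1) p = real (length p)" for p :: "('a \<times> 'a) list"
    by (simp add: awalk_cost_def sum_list_triv)
  obtain p where "awalk u p v"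
    using assms(2) by (auto simp: reachable_awalk)
  then have "\<exists>k p. awalk u p v \<and> length p = k" by blast
  then have "\<exists>p. awalk u p v \<and> length p = graph_dist G u v"
    unfolding graph_dist_def by (rule LeastI_ex)
  then obtain q where q: "awalk u q v" "length q = graph_dist G u v" by blast
  have le: "graph_dist G u v \<le> length p" if "awalk u p v" for p
    unfolding graph_dist_def using that by (intro Least_le) blast
  show ?thesis
    unfolding \<mu>_def cost
  proof (rule INF_eqI)
    fix p assume "p \<in> {p. awalk u p v}"
    then show "ereal (real (graph_dist G u v)) \<le> ereal (real (length p))"
      using le by simp
  next
    fix y assume "\<And>p. p \<in> {p. awalk u p v} \<Longrightarrow> y \<le> ereal (real (length p))"
    from this[of q] q show "y \<le> ereal (real (graph_dist G u v))" by simp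
  qed
qed

definition eccentricity :: "'a pair_pre_digraph \<Rightarrow> 'a \<Rightarrow> nat" where
  "eccentricity G v = Max ((\<lambda>u. graph_dist G v u) ` pverts G)"

definition ecc_entry :: "'a pair_pre_digraph \<Rightarrow> 'a \<Rightarrow> 'a \<Rightarrow> real" where
  "ecc_entry G u v =
     (if graph_dist G u v = min (eccentricity G u) (eccentricity G v)
      then real (graph_dist G u v) else 0)"

text \<open>
  Matrices are indexed by \<open>0..<n\<close>, so the vertices are enumerated in increasing order; another
  enumeration would permute rows and columns simultaneously and leave the spectrum unchanged.
\<close>

definition ecc_matrix :: "'a::linorder pair_pre_digraph \<Rightarrow> real mat" where
  "ecc_matrix G =
     (let vs = sorted_list_of_set (pverts G)
      in mat (graph_order G) (graph_order G) (\<lambda>(i, j). ecc_entry G (vs ! i) (vs ! j)))"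

text \<open>
  Eigenvalues are counted with multiplicity as roots of the characteristic polynomial. The matrix
  is real symmetric, so no eigenvalue is lost by working over the reals.
\<close>

definition ecc_spectrum :: "'a::linorder pair_pre_digraph \<Rightarrow> real multiset" where
  "ecc_spectrum G = proots (char_poly (ecc_matrix G))"

definition ecc_energy :: "'a::linorder pair_pre_digraph \<Rightarrow> real" where
  "ecc_energy G = (\<Sum>x\<in>#ecc_spectrum G. \<bar>x\<bar>)"

definition ecc_non_cospectral ::
  "'a::linorder pair_pre_digraph \<Rightarrow> 'b::linorder pair_pre_digraph \<Rightarrow> bool" where
  "ecc_non_cospectral G H \<longleftrightarrow>
     graph_order G = graph_order H \<and> \<not> graph_isomorphic G H \<and> ecc_spectrum G \<noteq> ecc_spectrum H"

definition ecc_equienergetic ::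
  "'a::linorder pair_pre_digraph \<Rightarrow> 'b::linorder pair_pre_digraph \<Rightarrow> bool" where
  "ecc_equienergetic G H \<longleftrightarrow> graph_order G = graph_order H \<and> ecc_energy G = ecc_energy H"

text \<open>Equality of the unordered pairs \<open>{G1, G2}\<close> and \<open>{H1, H2}\<close> up to isomorphism.\<close>

definition same_unordered_pair ::
  "'a pair_pre_digraph \<times> 'a pair_pre_digraph \<Rightarrow> 'b pair_pre_digraph \<times> 'b pair_pre_digraph \<Rightarrow> bool"
where
  "same_unordered_pair = (\<lambda>(G1, G2) (H1, H2).
     (graph_isomorphic G1 H1 \<and> graph_isomorphic G2 H2) \<or>
     (graph_isomorphic G1 H2 \<and> graph_isomorphic G2 H1))"

end

theory Submission
  imports Defs
begin

text \<open>
  If every vertex of a graph has eccentricity 2, its eccentricity matrix is twice the adjacency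
  matrix of its complement, so it suffices to find equienergetic complements. The 4-cycle, with
  spectrum \<open>2, 0, 0, -2\<close>, and two disjoint edges, with spectrum \<open>1, 1, -1, -1\<close>, both have energy 4.
  Hence the complements of \<open>k\<close> 4-cycles together with a perfect matching on the remaining
  vertices of a fixed even number of vertices all have the same \<open>\<epsilon>\<close>-energy, whereas \<open>k\<close> is the
  multiplicity of the \<open>\<epsilon>\<close>-eigenvalue 4. The two pairs are \<open>k \<in> {0, 1}\<close> and \<open>k \<in> {0, 2}\<close>.
\<close>

section \<open>Graphs with all eccentricities equal to 2\<close>

definition complement_graph :: "nat \<Rightarrow> (nat \<Rightarrow> nat \<Rightarrow> bool) \<Rightarrow> nat pair_pre_digraph" where
  "complement_graph n R =
     \<lparr>pverts = {..<n}, parcs = {(u, v). u < n \<and> v < n \<and> u \<noteq> v \<and> \<not> R u v}\<rparr>"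

lemma complement_graph_simps [simp]:
  "pverts (complement_graph n R) = {..<n}"
  "(u, v) \<in> parcs (complement_graph n R) \<longleftrightarrow> u < n \<and> v < n \<and> u \<noteq> v \<and> \<not> R u v"
  by (auto simp: complement_graph_def)

lemma finite_parcs_complement_graph [simp]: "finite (parcs (complement_graph n R))"
  by (rule finite_subset[of _ "{..<n} \<times> {..<n}"]) auto

lemma graph_order_complement_graph [simp]: "graph_order (complement_graph n R) = n"
  by (simp add: graph_order_def)

lemma pair_graph_complement_graph:
  assumes "symp R"
  shows "pair_graph (complement_graph n R)"
proof
  show "symmetric (with_proj (complement_graph n R))"
    using assms by (auto simp: symmetric_def sym_def dest: sympD)
qed auto

section \<open>Distances computed from explicit walks\<close>

lemma awalk_with_proj_iff:
  "pre_digraph.awalk (with_proj G) u p v \<longleftrightarrow> u \<in> pverts G \<and> set p \<subseteq> parcs G \<and> pcas u p v"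
  by (simp add: pre_digraph.awalk_def cas_with_proj_eq)

lemma graph_dist_le:
  assumes "u \<in> pverts G" "set p \<subseteq> parcs G" "pcas u p v" "length p \<le> k"
  shows "graph_dist G u v \<le> k"
proof -
  have "graph_dist G u v \<le> length p"
    unfolding graph_dist_def using assms by (intro Least_le) (auto simp: awalk_with_proj_iff)
  with assms show ?thesis by simp
qed

lemma graph_dist_eq_2:
  assumes "u \<in> pverts G" "(u, w) \<in> parcs G" "(w, v) \<in> parcs G"
    and "u \<noteq> v" "(u, v) \<notin> parcs G"
  shows "graph_dist G u v = 2"
  unfolding graph_dist_def
proof (rule Least_equality)
  show "\<exists>p. pre_digraph.awalk (with_proj G) u p v \<and> length p = 2"
    using assms by (intro exI[of _ "[(u, w), (w, v)]"]) (simp add: awalk_with_proj_iff)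
next
  fix k
  assume "\<exists>p. pre_digraph.awalk (with_proj G) u p v \<and> length p = k"
  then obtain p where p: "set p \<subseteq> parcs G" "pcas u p v" "length p = k"
    by (auto simp: awalk_with_proj_iff)
  show "2 \<le> k"
  proof (rule ccontr)
    assume "\<not> 2 \<le> k"
    then consider "p = []" | e where "p = [e]"
      using p(3) by (cases p rule: list.exhaust; cases "tl p") auto
    then show False using p assms by cases (auto simp: prod_eq_iff)
  qed
qed

text \<open>\<open>R\<close> is adjacency in the complement. In the graph itself,
  \<open>common_neighbour\<close> joins distinct non-adjacent vertices by a path of length 2, and
  \<open>partner\<close> keeps every eccentricity from dropping below 2.\<close>

locale complement_of_diameter_2 =
  fixes n :: nat and R :: "nat \<Rightarrow> nat \<Rightarrow> bool"
  assumes symmetric_R: "symp R" and irreflexive_R: "irreflp R"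
    and nonempty: "0 < n"
    and partner: "\<And>u. u < n \<Longrightarrow> \<exists>v<n. R u v"
    and common_neighbour:
      "\<And>u v. u < n \<Longrightarrow> v < n \<Longrightarrow> R u v \<Longrightarrow> \<exists>w<n. w \<noteq> u \<and> w \<noteq> v \<and> \<not> R u w \<and> \<not> R w v"
begin

lemma dist_related: "graph_dist (complement_graph n R) u v = 2"
  if "u < n" "v < n" "R u v"
  using common_neighbour[OF that] that irreflexive_R
  by (auto intro!: graph_dist_eq_2 dest: irreflpD)

lemma dist_unrelated: "graph_dist (complement_graph n R) u v \<le> 1"
  if "u < n" "v < n" "\<not> R u v"
proof (cases "u = v")
  case True
  then show ?thesis using that by (intro graph_dist_le[of _ _ "[]"]) auto
next
  case False
  then show ?thesis using that by (intro graph_dist_le[of _ _ "[(u, v)]"]) auto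
qed

lemma eccentricity_eq_2: "eccentricity (complement_graph n R) u = 2" if u: "u < n"
  unfolding eccentricity_def
proof (rule Max_eqI)
  obtain v where "v < n" "R u v" using partner[OF u] by blast
  with u dist_related
  show "2 \<in> (\<lambda>v. graph_dist (complement_graph n R) u v) ` pverts (complement_graph n R)"
    by (metis complement_graph_simps(1) image_eqI lessThan_iff)
next
  fix y
  assume "y \<in> (\<lambda>v. graph_dist (complement_graph n R) u v) ` pverts (complement_graph n R)"
  then obtain v where "v < n" "y = graph_dist (complement_graph n R) u v" by auto
  then show "y \<le> 2"
    using dist_related[OF u, of v] dist_unrelated[OF u, of v] by (cases "R u v") auto
qed simp

text \<open>The minimum of two eccentricities is always 2 here, so exactly the pairs at distance 2
  survive, and these are the \<open>R\<close>-related ones.\<close>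

lemma ecc_entry_eq: "ecc_entry (complement_graph n R) u v = (if R u v then 2 else 0)"
  if "u < n" "v < n"
  using dist_related[OF that] dist_unrelated[OF that] eccentricity_eq_2 that
  by (cases "R u v") (auto simp: ecc_entry_def)

lemma ecc_matrix_eq:
  "ecc_matrix (complement_graph n R) = mat n n (\<lambda>(u, v). if R u v then 2 else 0)"
proof -
  have "sorted_list_of_set {..<n} = [0..<n]"
    by (simp add: lessThan_atLeast0)
  then show ?thesis
    by (intro eq_matI) (simp_all add: ecc_matrix_def Let_def ecc_entry_eq)
qed

lemma connected_simple: "connected_simple_graph (complement_graph n R)"
proof -
  let ?G = "complement_graph n R"
  interpret G: pair_graph ?G by (rule pair_graph_complement_graph[OF symmetric_R])
  have "u \<rightarrow>\<^sup>*\<^bsub>with_proj ?G\<^esub> v" if uv: "u < n" "v < n" for u v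
  proof -
    have "\<exists>p. set p \<subseteq> parcs ?G \<and> pcas u p v"
    proof (cases "R u v")
      case True
      then obtain w where "w < n" "w \<noteq> u" "w \<noteq> v" "\<not> R u w" "\<not> R w v"
        using common_neighbour uv by blast
      then show ?thesis using uv by (intro exI[of _ "[(u, w), (w, v)]"]) simp
    next
      case False
      then show ?thesis
        using uv by (intro exI[of _ "if u = v then [] else [(u, v)]"]) simp
    qed
    then show ?thesis
      using uv by (auto simp: G.reachable_awalk awalk_with_proj_iff)
  qed
  then have "Digraph_Component.connected (with_proj ?G)"
    using nonempty by (intro G.connectedI) (auto intro: G.reachable_mk_symmetricI)
  then show ?thesis
    by (simp add: connected_simple_graph_def G.pair_graph_axioms)
qed

end

section \<open>The characteristic polynomial\<close>

text \<open>Serves to split components off the complement. The second block reads \<open>f\<close>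
  at indices shifted by \<open>a\<close>, the form that the later inductions on the number of
  components need.\<close>

lemma char_poly_block_diagonal:
  fixes f :: "nat \<Rightarrow> nat \<Rightarrow> 'a :: idom"
  assumes "\<And>i j. i < a \<Longrightarrow> a \<le> j \<Longrightarrow> f i j = 0" "\<And>i j. a \<le> i \<Longrightarrow> j < a \<Longrightarrow> f i j = 0"
  shows "char_poly (mat (a + b) (a + b) (\<lambda>(i, j). f i j)) =
    char_poly (mat a a (\<lambda>(i, j). f i j)) * char_poly (mat b b (\<lambda>(i, j). f (a + i) (a + j)))"
proof -
  let ?A = "char_poly_matrix (mat a a (\<lambda>(i, j). f i j))"
  let ?B = "char_poly_matrix (mat b b (\<lambda>(i, j). f (a + i) (a + j)))"
  have "char_poly_matrix (mat (a + b) (a + b) (\<lambda>(i, j). f i j)) =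
      four_block_mat ?A (0\<^sub>m a b) (0\<^sub>m b a) ?B"
    using assms by (intro eq_matI) (auto simp: char_poly_matrix_def not_less)
  moreover have "det (four_block_mat ?A (0\<^sub>m a b) (0\<^sub>m b a) ?B) = det ?A * det ?B"
    by (rule det_four_block_mat_lower_left_zero) (auto simp: char_poly_matrix_def)
  ultimately show ?thesis by (simp add: char_poly_def)
qed

text \<open>
  The first \<open>k\<close> blocks of four consecutive numbers carry 4-cycles (bipartitioned by parity), the
  other numbers are matched as \<open>2i, 2i + 1\<close>.
\<close>

definition cycles_matching :: "nat \<Rightarrow> nat \<Rightarrow> nat \<Rightarrow> bool" where
  "cycles_matching k i j \<longleftrightarrow>
     odd (i + j) \<and> (i div 2 = j div 2 \<or> i div 4 = j div 4 \<and> i div 4 < k)"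

abbreviation cycles_matching_mat :: "nat \<Rightarrow> nat \<Rightarrow> real mat" where
  "cycles_matching_mat k n \<equiv> mat n n (\<lambda>(i, j). if cycles_matching k i j then 2 else 0)"

text \<open>Components stay inside blocks of four. This makes off-diagonal matrix blocks vanish and
  supplies vertices unrelated to both ends of an edge.\<close>

lemma cycles_matching_imp_div_4_eq:
  assumes "cycles_matching k i j"
  shows "i div 4 = j div 4"
proof -
  \<comment> \<open>Equal quotients by 2 thus force equal quotients by 4, which covers the matching
    edges.\<close>
  have "a div 4 = a div 2 div 2" for a :: nat by (simp flip: div_mult2_eq)
  with assms show ?thesis by (metis cycles_matching_def)
qed

text \<open>Laplace expansion along the first row, phrased with entry functions so that
  simplification evaluates determinants of concrete size.\<close>

lemma det_mat_Suc:
  fixes f :: "nat \<times> nat \<Rightarrow> 'a :: comm_ring_1"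
  shows "det (mat (Suc n) (Suc n) f) =
    (\<Sum>j<Suc n. f (0, j) * ((-1) ^ j *
      det (mat n n (\<lambda>(i, l). f (Suc i, if l < j then l else Suc l)))))"
proof -
  have "mat_delete (mat (Suc n) (Suc n) f) 0 j =
      mat n n (\<lambda>(i, l). f (Suc i, if l < j then l else Suc l))" for j
    by (auto simp: mat_delete_def intro!: eq_matI)
  then show ?thesis
    by (subst laplace_expansion_row[of _ "Suc n" 0]) (simp_all add: cofactor_def)
qed

lemma char_poly_matrix_mat:
  "char_poly_matrix (mat n n f) =
    mat n n (\<lambda>(i, j). if i = j then [:- f (i, j), 1:] else [:- f (i, j):])"
  by (auto simp: char_poly_matrix_def intro!: eq_matI)

lemma char_poly_matching_block:
  "char_poly (cycles_matching_mat 0 2) = [:-2, 1:] * [:2, 1:]"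
  by (simp add: char_poly_def char_poly_matrix_mat det_mat_Suc numeral_2_eq_2 cycles_matching_def)

text \<open>The matrix is twice the adjacency matrix of a 4-cycle; \<open>Suc k\<close> guarantees
  that the first block is a cycle.\<close>

lemma char_poly_cycle_block:
  "char_poly (cycles_matching_mat (Suc k) 4) = [:0, 1:] * [:0, 1:] * [:-4, 1:] * [:4, 1:]"
proof -
  have block: "cycles_matching (Suc k) i j \<longleftrightarrow> odd (i + j)" if "i < 4" "j < 4" for i j
    using that by (auto simp: cycles_matching_def)
  have "char_poly (cycles_matching_mat (Suc k) 4) =
      det (mat 4 4 (\<lambda>(i, j). if i = j then [:0, 1:] else if odd (i + j) then [:-2:] else 0))"
    unfolding char_poly_def char_poly_matrix_mat
    by (rule arg_cong[where f = det], rule eq_matI) (simp_all add: block)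
  \<comment> \<open>Successor form is what \<open>det_mat_Suc\<close> matches.\<close>
  moreover have "(4 :: nat) = Suc (Suc (Suc (Suc 0)))" by simp
  ultimately show ?thesis
    by (simp only:) (simp add: det_mat_Suc)
qed

lemma char_poly_matching:
  "char_poly (cycles_matching_mat 0 (2 * m)) = ([:-2, 1:] * [:2, 1:]) ^ m"
proof (induction m)
  case 0
  show ?case by (simp add: char_poly_def char_poly_matrix_def)
next
  case (Suc m)
  have "cycles_matching 0 (2 + i) (2 + j) = cycles_matching 0 i j" for i j
    by (simp add: cycles_matching_def)
  moreover have "\<not> cycles_matching 0 i j" if "i < 2 \<and> 2 \<le> j \<or> j < 2 \<and> 2 \<le> i" for i j
    using that by (auto simp: cycles_matching_def div_eq_0_iff dest: sym)
  ultimately have "char_poly (cycles_matching_mat 0 (2 + 2 * m)) =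
      char_poly (cycles_matching_mat 0 2) * char_poly (cycles_matching_mat 0 (2 * m))"
    using char_poly_block_diagonal[of 2 "\<lambda>i j. if cycles_matching 0 i j then 2 else 0 :: real" "2 * m"]
    by simp
  then show ?case by (simp only: Suc.IH char_poly_matching_block) simp
qed

text \<open>The induction splits off the first 4-cycle: shifting indices by 4 turns
  \<open>Suc k\<close> into \<open>k\<close>, until only the matching remains.\<close>

lemma char_poly_cycles_matching:
  "char_poly (cycles_matching_mat k (4 * k + 2 * m)) =
    ([:0, 1:] * [:0, 1:] * [:-4, 1:] * [:4, 1:]) ^ k * ([:-2, 1:] * [:2, 1:]) ^ m"
proof (induction k)
  case 0
  show ?case using char_poly_matching[of m] by simp
next
  case (Suc k)
  have "cycles_matching (Suc k) (4 + i) (4 + j) = cycles_matching k i j" for i j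
  proof -
    have "(4 + i) div 2 = 2 + i div 2" "(4 + i) div 4 = 1 + i div 4" for i :: nat
      by presburger+
    then show ?thesis by (simp add: cycles_matching_def)
  qed
  moreover have "\<not> cycles_matching (Suc k) i j" if "i < 4 \<and> 4 \<le> j \<or> j < 4 \<and> 4 \<le> i" for i j
  proof -
    have "i div 4 \<noteq> j div 4" using that by (auto simp: div_eq_0_iff dest: sym)
    then show ?thesis using cycles_matching_imp_div_4_eq by blast
  qed
  ultimately have "char_poly (cycles_matching_mat (Suc k) (4 + (4 * k + 2 * m))) =
      char_poly (cycles_matching_mat (Suc k) 4) * char_poly (cycles_matching_mat k (4 * k + 2 * m))"
    using char_poly_block_diagonal[of 4
        "\<lambda>i j. if cycles_matching (Suc k) i j then 2 else 0 :: real" "4 * k + 2 * m"]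
    by simp
  moreover have "4 * Suc k + 2 * m = 4 + (4 * k + 2 * m)" by simp
  ultimately show ?case
    by (simp only: Suc.IH char_poly_cycle_block power_Suc mult.assoc)
qed

section \<open>Equienergetic complements\<close>

abbreviation cycles_matching_graph :: "nat \<Rightarrow> nat \<Rightarrow> nat pair_pre_digraph" where
  "cycles_matching_graph k n \<equiv> complement_graph n (cycles_matching k)"

lemma complement_of_diameter_2_cycles_matching:
  assumes "even n" "8 \<le> n"
  shows "complement_of_diameter_2 n (cycles_matching k)"
proof
  show "symp (cycles_matching k)"
    by (auto simp: symp_def cycles_matching_def)
  show "irreflp (cycles_matching k)"
    by (auto simp: irreflp_def cycles_matching_def)
  show "0 < n" using assms by simp
next
  fix u
  assume u: "u < n"
  \<comment> \<open>The partner in the matching; evenness of \<open>n\<close> keeps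
    \<open>u + 1\<close> in range.\<close>
  define v where "v = (if even u then u + 1 else u - 1)"
  have "v < n" "odd (u + v)" "u div 2 = v div 2"
    using u assms(1) unfolding v_def by presburger+
  then show "\<exists>v<n. cycles_matching k u v"
    by (auto simp: cycles_matching_def)
next
  fix u v
  assume "u < n" "v < n" "cycles_matching k u v"
  then have "u div 4 = v div 4" by (simp add: cycles_matching_imp_div_4_eq)
  \<comment> \<open>A vertex outside the common block of \<open>u\<close> and \<open>v\<close>,
    hence adjacent to both in the graph.\<close>
  define w where "w = (if u < 4 then 4 else 0 :: nat)"
  have "w div 4 \<noteq> u div 4" by (auto simp: w_def)
  with \<open>u div 4 = v div 4\<close>
  have "w \<noteq> u \<and> w \<noteq> v \<and> \<not> cycles_matching k u w \<and> \<not> cycles_matching k w v"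
    using cycles_matching_imp_div_4_eq by metis
  moreover have "w < n" using assms by (simp add: w_def)
  ultimately show "\<exists>w<n. w \<noteq> u \<and> w \<noteq> v \<and> \<not> cycles_matching k u w \<and> \<not> cycles_matching k w v"
    by blast
qed

lemma ecc_spectrum_cycles_matching_graph:
  assumes "n = 4 * k + 2 * m" "8 \<le> n"
  shows "ecc_spectrum (cycles_matching_graph k n) =
    repeat_mset k {#0, 0, 4, -4#} + repeat_mset m {#2, -2#}"
proof -
  interpret complement_of_diameter_2 n "cycles_matching k"
    using assms by (intro complement_of_diameter_2_cycles_matching) auto
  \<comment> \<open>\<open>proots\<close> turns products into sums only when the product is
    nonzero.\<close>
  have nonzero: "[:a, 1:] \<noteq> 0" for a :: real by simp
  have "char_poly (ecc_matrix (cycles_matching_graph k n)) =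
      ([:0, 1:] * [:0, 1:] * [:-4, 1:] * [:4, 1:]) ^ k * ([:-2, 1:] * [:2, 1:]) ^ m"
    unfolding ecc_matrix_eq by (simp only: assms(1) char_poly_cycles_matching)
  moreover have "proots \<dots> = repeat_mset k ({#0#} + {#0#} + {#4#} + {#-4#}) +
      repeat_mset m ({#2#} + {#-2#})"
    by (simp only: proots_mult proots_power proots_linear_factor power_not_zero mult_eq_0_iff
        nonzero simp_thms minus_zero minus_minus)
  ultimately show ?thesis
    by (simp add: ecc_spectrum_def add_mset_commute)
qed

text \<open>Each 4-cycle contributes 8 and each matching edge 4, that is 2 per vertex, whatever
  \<open>k\<close> is.\<close>

lemma ecc_energy_cycles_matching_graph:
  assumes "n = 4 * k + 2 * m" "8 \<le> n"
  shows "ecc_energy (cycles_matching_graph k n) = 2 * real n"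
proof -
  have repeat: "(\<Sum>x\<in>#repeat_mset c M. \<bar>x\<bar>) = real c * (\<Sum>x\<in>#M. \<bar>x\<bar>)"
    for c and M :: "real multiset"
    by (induction c) (simp_all only: repeat_mset_Suc repeat_mset_0 image_mset_union
        image_mset_empty sum_mset.union sum_mset.empty of_nat_Suc of_nat_0 distrib_right
        mult_1_left mult_zero_left)
  show ?thesis
    unfolding ecc_energy_def ecc_spectrum_cycles_matching_graph[OF assms]
    by (simp only: image_mset_union sum_mset.union repeat) (simp add: assms(1))
qed

text \<open>Recovers \<open>k\<close> from the spectrum, so different \<open>k\<close> give
  different spectra.\<close>

lemma count_ecc_spectrum_cycles_matching_graph:
  assumes "n = 4 * k + 2 * m" "8 \<le> n"
  shows "count (ecc_spectrum (cycles_matching_graph k n)) 4 = k"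
  by (simp add: ecc_spectrum_cycles_matching_graph[OF assms])

section \<open>Non-isomorphism by counting arcs\<close>

lemma graph_isomorphic_imp_card_parcs_eq:
  assumes "graph_isomorphic G H"
  shows "card (parcs G) = card (parcs H)"
proof -
  from assms obtain f where f: "pre_digraph.digraph_isomorphism (with_proj G) f"
    and H: "with_proj H = app_iso f (with_proj G)"
    by (auto simp: graph_isomorphic_def digraph_iso_def)
  from H have "parcs H = iso_arcs f ` parcs G"
    by (metis arcs_app_iso with_proj_simps(2))
  with f show ?thesis
    by (simp add: pre_digraph.digraph_isomorphism_def card_image)
qed

text \<open>Completing matched blocks to 4-cycles only adds related pairs, so the complement loses
  arcs.\<close>

lemma card_parcs_cycles_matching_graph_less:
  assumes "k < l" "4 * l \<le> n"
  shows "card (parcs (cycles_matching_graph l n)) < card (parcs (cycles_matching_graph k n))"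
proof (rule psubset_card_mono)
  have "cycles_matching l i j" if "cycles_matching k i j" for i j
    using that assms(1) by (auto simp: cycles_matching_def)
  then have "parcs (cycles_matching_graph l n) \<subseteq> parcs (cycles_matching_graph k n)"
    by auto
  \<comment> \<open>An edge of the 4-cycle on block \<open>k\<close> (counted from 0) that is not a
    matching edge; this block is a cycle for \<open>l\<close> but not for \<open>k\<close>.\<close>
  moreover have "(4 * k, 4 * k + 3) \<in> parcs (cycles_matching_graph k n)"
    using assms by (auto simp: cycles_matching_def)
  moreover have "(4 * k, 4 * k + 3) \<notin> parcs (cycles_matching_graph l n)"
    using assms by (auto simp: cycles_matching_def)
  ultimately show "parcs (cycles_matching_graph l n) \<subset> parcs (cycles_matching_graph k n)"
    by blast
qed simp

lemma not_isomorphic_cycles_matching_graph: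
  assumes "k \<noteq> l" "4 * k \<le> n" "4 * l \<le> n"
  shows "\<not> graph_isomorphic (cycles_matching_graph k n) (cycles_matching_graph l n)"
  using assms card_parcs_cycles_matching_graph_less[of k l n]
    card_parcs_cycles_matching_graph_less[of l k n] graph_isomorphic_imp_card_parcs_eq
  by (metis less_irrefl nat_neq_iff)

theorem corollary5p6:
  fixes t :: nat
  assumes "t \<ge> 3"
  shows "\<exists>G1 G2 H1 H2 :: nat pair_pre_digraph.
    (\<forall>G \<in> {G1, G2, H1, H2}. connected_simple_graph G \<and> graph_order G = 6 + 6 * t) \<and>
    ecc_non_cospectral G1 G2 \<and> ecc_equienergetic G1 G2 \<and>
    ecc_non_cospectral H1 H2 \<and> ecc_equienergetic H1 H2 \<and>
    \<not> same_unordered_pair (G1, G2) (H1, H2)"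
proof -
  define n where "n = 6 + 6 * t"
  \<comment> \<open>The number of matching edges beside \<open>k\<close> 4-cycles; the subtraction
    is not truncated for \<open>k\<close> up to 2.\<close>
  define m where "m k = 3 + 3 * t - 2 * k" for k
  let ?G = "\<lambda>k. cycles_matching_graph k n"
  have n: "8 \<le> n" using assms by (simp add: n_def)
  have split: "n = 4 * k + 2 * m k" if "k \<le> 2" for k
    using that assms by (simp add: n_def m_def)
  have simple: "connected_simple_graph (?G k)" if "k \<le> 2" for k
    by (intro complement_of_diameter_2.connected_simple complement_of_diameter_2_cycles_matching n)
      (auto simp: n_def)
  have non_iso: "\<not> graph_isomorphic (?G k) (?G l)" if "k \<le> 2" "l \<le> 2" "k \<noteq> l" for k l
    using not_isomorphic_cycles_matching_graph that split by (metis le_add1)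
  have non_cospectral: "ecc_non_cospectral (?G k) (?G l)" if "k \<le> 2" "l \<le> 2" "k \<noteq> l" for k l
    using count_ecc_spectrum_cycles_matching_graph[OF split n] that non_iso[OF that]
    by (metis ecc_non_cospectral_def graph_order_complement_graph)
  have equienergetic: "ecc_equienergetic (?G k) (?G l)" if "k \<le> 2" "l \<le> 2" for k l
    using ecc_energy_cycles_matching_graph[OF split n] that by (simp add: ecc_equienergetic_def)
  \<comment> \<open>The pairs share \<open>?G 0\<close>; either way of matching them would make
    \<open>?G 2\<close> isomorphic to \<open>?G 1\<close> or \<open>?G 0\<close>.\<close>
  have "\<not> same_unordered_pair (?G 0, ?G 1) (?G 0, ?G 2)"
    using non_iso[of 0 2] non_iso[of 1 2] by (auto simp: same_unordered_pair_def)
  then show ?thesis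
    unfolding n_def[symmetric]
    using simple non_cospectral[of 0 1] non_cospectral[of 0 2]
      equienergetic[of 0 1] equienergetic[of 0 2]
    \<comment> \<open>\<open>?G 0\<close> fills both \<open>G1\<close> and \<open>H1\<close>, so
      three witnesses serve four quantifiers.\<close>
    by (intro exI[of _ "?G 0"] exI[of _ "?G 1"] exI[of _ "?G 2"]) simp
qed

end
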